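(* Let $\varphi \in [0,1)$ and let $f : \mathbb{N} \to \mathbb{R}$ be such that $\Delta f(n) \to \psi \in \mathbb{R}$ as $n \to \infty$. If $\frac{1}{N}\sum_{n=1}^{N} |\Delta f(n) + \varphi| \to 0$ as $N \to \infty$ and $y_n = e(f(n))$ for $n \ge 1$, then every solution $\{x_n\}_{n\ge1} \subset \mathbb{C}$ (i.e. for every initial value $x_1 \in \mathbb{C}$) of the difference equation $$x_{n+1} = e(-\varphi)\,x_n + y_n, \quad n \ge 1,$$ is unbounded.
   Context: $\mathbb{N} = \{1,2,3,\ldots\}$. For real $x$, $e(x) := e^{2\pi i x}$. For $f : \mathbb{N} \to \mathbb{R}$, $\Delta f(n) := f(n+1) - f(n)$. *)

theory Defs
  imports "HOL-Analysis.Analysis"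
begin

text \<open>Sequences indexed by the positive integers are functions on \<^typ>\<open>nat\<close> of which only the
  values at arguments \<open>n \<ge> 1\<close> are used; the value at 0 is irrelevant.\<close>

definition expi :: "real \<Rightarrow> complex" where
  "expi x = exp (2 * of_real pi * \<i> * of_real x)"

definition fdiff :: "(nat \<Rightarrow> real) \<Rightarrow> nat \<Rightarrow> real" where
  "fdiff f n = f (n + 1) - f n"

end

theory Submission imports Defs begin

text \<open>A Cesaro mean of a convergent sequence has the same limit, so \<open>\<psi> = - \<phi>\<close>. The rotated sequence
  \<open>e(n\<phi>) x\<^sub>n\<close> has the same moduli as \<open>x\<^sub>n\<close>, and its increments are unimodular with consecutive
  increments asymptotically equal. Hence \<open>k\<close> consecutive steps far out move it by almost \<open>k\<close>,
  for every \<open>k\<close>.\<close>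

text \<open>For fixed \<open>k\<close> the difference telescopes into \<open>k\<close> null
  sequences.\<close>

lemma shift_diff_tendsto_zero:
  fixes w :: "nat \<Rightarrow> 'a::real_normed_vector"
  assumes "(\<lambda>n. w (Suc n) - w n) \<longlonglongrightarrow> 0"
  shows "(\<lambda>n. w (n + k) - w n) \<longlonglongrightarrow> 0"
proof (induction k)
  case (Suc k)
  have "(\<lambda>n. w (Suc (n + k)) - w (n + k)) \<longlonglongrightarrow> 0"
    by (rule LIMSEQ_ignore_initial_segment[OF assms])
  from tendsto_add[OF this Suc.IH] show ?case by simp
qed simp

lemma unbounded_if_unit_steps_slowly_varying:
  fixes z :: "nat \<Rightarrow> 'a::real_normed_vector"
  defines "w \<equiv> \<lambda>n. z (Suc n) - z n"
  assumes unit: "\<And>n. norm (w n) = 1"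
    and slow: "(\<lambda>n. w (Suc n) - w n) \<longlonglongrightarrow> 0"
  shows "\<not> bounded (range z)"
proof
  assume "bounded (range z)"
  then obtain B where B: "norm (z n) \<le> B" for n
    by (auto simp: bounded_iff)
  \<comment> \<open>Each of the \<open>k\<close> steps after \<open>n\<close> is asymptotically
    \<open>w n\<close>. Raising \<open>k\<close> by one adds the error
    \<open>w (n + k) - w n\<close>, which tends to 0.\<close>
  have steps: "(\<lambda>n. z (n + k) - z n - real k *\<^sub>R w n) \<longlonglongrightarrow> 0" for k
  proof (induction k)
    case (Suc k)
    from tendsto_add[OF Suc.IH shift_diff_tendsto_zero[OF slow, of k]]
    show ?case by (simp add: w_def algebra_simps)
  qed simp
  \<comment> \<open>Boundedness allows a displacement of at most \<open>2 * B\<close>; the extra 1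
    absorbs the approximation error.\<close>
  obtain k :: nat where k: "real k > 2 * B + 1"
    using reals_Archimedean2 by blast
  obtain n where n: "norm (z (n + k) - z n - real k *\<^sub>R w n) < 1"
    using LIMSEQ_D[OF steps[of k] zero_less_one] by auto
  have "real k = norm (real k *\<^sub>R w n)"
    by (simp add: unit)
  also have "\<dots> \<le> norm (z (n + k)) + norm (z n) + norm (z (n + k) - z n - real k *\<^sub>R w n)"
    using norm_triangle_ineq4[of "z (n + k) - z n" "z (n + k) - z n - real k *\<^sub>R w n"]
      norm_triangle_ineq4[of "z (n + k)" "z n"] by simp
  finally show False
    using B[of "n + k"] B[of n] n k by linarith
qed

text \<open>If \<open>c\<close> were positive, all late terms would exceed \<open>c / 2\<close>. The
  early terms cannot offset them, being nonnegative, so the means would stay away from 0.\<close>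

lemma cesaro_mean_limit_nonpos:
  fixes a :: "nat \<Rightarrow> real"
  assumes lim: "a \<longlonglongrightarrow> c" and nonneg: "\<And>n. 0 \<le> a n"
    and mean: "(\<lambda>N. 1 / real N * (\<Sum>n=1..N. a n)) \<longlonglongrightarrow> 0"
  shows "c \<le> 0"
proof (rule ccontr)
  assume "\<not> c \<le> 0"
  then have c: "c > 0" by simp
  have "\<forall>\<^sub>F n in sequentially. a n > c / 2"
    using order_tendstoD(1)[OF lim, of "c / 2"] c by simp
  then obtain M where M: "a n > c / 2" if "n \<ge> M" for n
    by (auto simp: eventually_sequentially)
  \<comment> \<open>For such \<open>N\<close> at least half of the indices up to \<open>N\<close>
    lie beyond \<open>M\<close>, and each contributes more than \<open>c / 2\<close>.\<close>
  have "c / 4 \<le> 1 / real N * (\<Sum>n=1..N. a n)" if N: "N \<ge> 2 * M + 1" for N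
  proof -
    have "real N / 2 * (c / 2) \<le> real (N - M) * (c / 2)"
      using N c by (intro mult_right_mono) auto
    also have "\<dots> = (\<Sum>n\<in>{M<..N}. c / 2)" by simp
    also have "\<dots> \<le> (\<Sum>n\<in>{M<..N}. a n)"
      using M by (intro sum_mono) (simp add: less_imp_le)
    also have "\<dots> \<le> (\<Sum>n=1..N. a n)"
      using nonneg by (intro sum_mono2) auto
    finally show ?thesis using N by (simp add: field_simps)
  qed
  then have "c / 4 \<le> 0"
    by (intro LIMSEQ_le_const[OF mean]) blast
  with c show False by simp
qed

lemma expi_eq_cis: "expi t = cis (2 * pi * t)"
  by (simp add: expi_def cis_conv_exp mult_ac)

lemma expi_add: "expi (s + t) = expi s * expi t"
  by (simp add: expi_eq_cis cis_mult algebra_simps)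

lemma norm_expi [simp]: "norm (expi t) = 1"
  by (simp add: expi_eq_cis)

lemma isCont_expi: "isCont expi t"
  unfolding expi_def by (intro continuous_intros)

theorem theorem2p15:
  fixes \<phi> \<psi> :: real and f :: "nat \<Rightarrow> real" and x y :: "nat \<Rightarrow> complex"
  assumes "0 \<le> \<phi>" and "\<phi> < 1"
    and "(\<lambda>n. fdiff f n) \<longlonglongrightarrow> \<psi>"
    and "(\<lambda>N. 1 / real N * (\<Sum>n=1..N. \<bar>fdiff f n + \<phi>\<bar>)) \<longlonglongrightarrow> 0"
    and "\<And>n. n \<ge> 1 \<Longrightarrow> y n = expi (f n)"
    and "\<And>n. n \<ge> 1 \<Longrightarrow> x (n + 1) = expi (- \<phi>) * x n + y n"
  shows "\<not> bounded (x ` {1..})"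
proof
  assume bdd: "bounded (x ` {1..})"
  \<comment> \<open>The averaged sequence itself converges, so its nonnegative limit must be
    0.\<close>
  have "(\<lambda>n. \<bar>fdiff f n + \<phi>\<bar>) \<longlonglongrightarrow> \<bar>\<psi> + \<phi>\<bar>"
    by (intro tendsto_intros assms(3))
  from cesaro_mean_limit_nonpos[OF this _ assms(4)] have "\<psi> + \<phi> = 0"
    by simp
  then have "(\<lambda>n. fdiff f n + \<phi>) \<longlonglongrightarrow> 0"
    using tendsto_add[OF assms(3) tendsto_const[of \<phi>]] by simp
  then have "(\<lambda>n. fdiff f (Suc n) + \<phi>) \<longlonglongrightarrow> 0"
    by (rule LIMSEQ_Suc)
  from isCont_tendsto_compose[OF isCont_expi this]
  have ratio: "(\<lambda>n. expi (fdiff f (Suc n) + \<phi>) - 1) \<longlonglongrightarrow> 0"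
    by (simp add: LIM_zero expi_eq_cis)
  \<comment> \<open>The rotation cancels the multiplier \<open>expi (- \<phi>)\<close>, leaving a
    pure summation with steps \<open>w n\<close>. The index is shifted by one because the recurrence
    starts at 1.\<close>
  define z where "z n = expi (real (Suc n) * \<phi>) * x (Suc n)" for n
  define w where "w n = expi (f (Suc n) + real (n + 2) * \<phi>)" for n
  have step: "z (Suc n) - z n = w n" for n
  proof -
    have "expi (real (n + 2) * \<phi>) * expi (- \<phi>) = expi (real (Suc n) * \<phi>)"
      and "expi (real (n + 2) * \<phi>) * expi (f (Suc n)) = w n"
      unfolding w_def expi_add[symmetric] by (simp_all add: algebra_simps)
    moreover have "z (Suc n) = expi (real (n + 2) * \<phi>) * (expi (- \<phi>) * x (Suc n) + expi (f (Suc n)))"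
      using assms(5,6)[of "Suc n"] by (simp add: z_def)
    ultimately show ?thesis
      by (simp only: z_def distrib_left mult.assoc[symmetric] add_diff_cancel_left')
  qed
  \<comment> \<open>Consecutive steps differ by the factor
    \<open>expi (fdiff f (Suc n) + \<phi>)\<close>, which tends to 1.\<close>
  have "w (Suc n) - w n = w n * (expi (fdiff f (Suc n) + \<phi>) - 1)" for n
    unfolding w_def right_diff_distrib expi_add[symmetric]
    by (simp add: fdiff_def algebra_simps)
  then have "norm (w (Suc n) - w n) = norm (expi (fdiff f (Suc n) + \<phi>) - 1)" for n
    by (simp add: norm_mult w_def)
  with tendsto_norm_zero[OF ratio] have "(\<lambda>n. w (Suc n) - w n) \<longlonglongrightarrow> 0"
    by (intro tendsto_norm_zero_cancel[where f = "\<lambda>n. w (Suc n) - w n"]) simp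
  then have "\<not> bounded (range z)"
    by (intro unbounded_if_unit_steps_slowly_varying) (simp_all add: step, simp add: w_def)
  moreover have "bounded (range z)"
    using bdd by (auto simp: bounded_iff z_def norm_mult)
  ultimately show False by contradiction
qed

end
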